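(* Let $n \ge 3$ be an integer and let $G$ be a connected finite simple graph of order $n$. Then $\alpha_1'(G) \ge 2$, with equality if and only if $G$ is isomorphic to one of $C_3, C_4, D_4, K_4, U_{1,3}, P_4, K_{1,n-1}$.
   Context: For a graph $G$, a $1$-nearly edge independent set of $G$ is a set $M \subseteq E(G)$ such that $M$ contains exactly one (unordered) pair of distinct edges that are adjacent in $G$ (i.e. share a common end vertex). The $1$-nearly edge independence number $\alpha_1'(G)$ is the maximum cardinality of a $1$-nearly edge independent set of $G$, taken to be $0$ if $G$ has no such set. $C_m$, $P_m$, $K_m$ denote the cycle, path and complete graph on $m$ vertices; $K_{1,n-1}$ is the star on $n$ vertices; $D_4 = K_4 - e$ (the diamond) is $K_4$ with one edge removed; $U_{1,3}$ is the graph obtained from the star $K_{1,3}$ by adding one edge (between two leaves), making it unicyclic. *)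

theory Defs
  imports "HOL-Library.Ramsey"
begin

text \<open>A graph is a vertex set together with a set of edges, an edge being the set of its end vertices.\<close>

type_synonym 'a ugraph = "'a set \<times> 'a set set"

abbreviation vertices :: "'a ugraph \<Rightarrow> 'a set" where
  "vertices G \<equiv> fst G"

abbreviation edges :: "'a ugraph \<Rightarrow> 'a set set" where
  "edges G \<equiv> snd G"

definition finite_simple_graph :: "'a ugraph \<Rightarrow> bool" where
  "finite_simple_graph G \<longleftrightarrow> finite (vertices G) \<and> edges G \<subseteq> nsets (vertices G) 2"

definition connected_graph :: "'a ugraph \<Rightarrow> bool" where
  "connected_graph G \<longleftrightarrow> vertices G \<noteq> {} \<and>
    (\<forall>u\<in>vertices G. \<forall>v\<in>vertices G. (u, v) \<in> {(x, y). {x, y} \<in> edges G}\<^sup>*)"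

definition graph_isomorphic :: "'a ugraph \<Rightarrow> 'b ugraph \<Rightarrow> bool" where
  "graph_isomorphic G H \<longleftrightarrow>
    (\<exists>f. bij_betw f (vertices G) (vertices H) \<and>
      (\<forall>u\<in>vertices G. \<forall>v\<in>vertices G. {u, v} \<in> edges G \<longleftrightarrow> {f u, f v} \<in> edges H))"

definition adjacent_edge_pairs :: "'a set set \<Rightarrow> 'a set set set" where
  "adjacent_edge_pairs M = {{e, f} | e f. e \<in> M \<and> f \<in> M \<and> e \<noteq> f \<and> e \<inter> f \<noteq> {}}"

definition one_nearly_edge_independent :: "'a ugraph \<Rightarrow> 'a set set \<Rightarrow> bool" where
  "one_nearly_edge_independent G M \<longleftrightarrow> M \<subseteq> edges G \<and> card (adjacent_edge_pairs M) = 1"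

definition one_nearly_edge_independence_number :: "'a ugraph \<Rightarrow> nat" where
  "one_nearly_edge_independence_number G =
    (if \<exists>M. one_nearly_edge_independent G M
     then Max {card M | M. one_nearly_edge_independent G M} else 0)"

definition path_graph :: "nat \<Rightarrow> nat ugraph" where
  "path_graph m = ({..<m}, {{i, i + 1} | i. i + 1 < m})"

text \<open>Only meaningful as a cycle for \<open>m \<ge> 3\<close>.\<close>

definition cycle_graph :: "nat \<Rightarrow> nat ugraph" where
  "cycle_graph m = ({..<m}, {{i, (i + 1) mod m} | i. i < m})"

definition complete_graph :: "nat \<Rightarrow> nat ugraph" where
  "complete_graph m = ({..<m}, nsets {..<m} 2)"

text \<open>The star on \<open>m\<close> vertices, that is \<open>K\<^bsub>1,m-1\<^esub>\<close>, with centre \<open>0\<close>.\<close>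

definition star_graph :: "nat \<Rightarrow> nat ugraph" where
  "star_graph m = ({..<m}, {{0, i} | i. 0 < i \<and> i < m})"

definition diamond_graph :: "nat ugraph" where
  "diamond_graph = (vertices (complete_graph 4), edges (complete_graph 4) - {{0, 1}})"

text \<open>\<open>U\<^bsub>1,3\<^esub>\<close>: \<open>K\<^bsub>1,3\<^esub>\<close> with an edge added between two leaves.\<close>

definition U13_graph :: "nat ugraph" where
  "U13_graph = (vertices (star_graph 4), insert {1, 2} (edges (star_graph 4)))"

end

theory Submission
  imports Defs
begin

text \<open>
  A 1-nearly edge independent set with at least three edges contains a path on three vertices
  together with an edge disjoint from it, so it occupies at least five vertices.  Two adjacent
  edges always exist, hence the number is \<open>2\<close> exactly for the graphs without such a configuration.
  A connected graph whose edges have no common vertex is a triangle or has two disjoint edges.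
  In the latter case a fifth vertex, attached by connectivity, would create the forbidden
  configuration, while on four vertices the graph is a path \<open>abcd\<close> plus some of the three
  remaining edges.  If the edges do have a common vertex, the graph is a star.
\<close>

text \<open>A cherry is a pair of distinct edges with a common end. When the members of
  \<open>E\<close> have two elements each, \<open>e\<close>, \<open>f\<close>, \<open>g\<close> form
  a copy of P_3 plus a disjoint K_2, the smallest obstruction to the value 2.\<close>

definition has_isolated_cherry :: "'a set set \<Rightarrow> bool" where
  "has_isolated_cherry E \<longleftrightarrow>
    (\<exists>e\<in>E. \<exists>f\<in>E. \<exists>g\<in>E. e \<noteq> f \<and> e \<inter> f \<noteq> {} \<and> g \<inter> (e \<union> f) = {})"

lemma has_isolated_cherryI:
  assumes "{x, y} \<in> E" "{x, z} \<in> E" "{u, v} \<in> E"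
    and "y \<noteq> z" "{u, v} \<inter> {x, y, z} = {}"
  shows "has_isolated_cherry E"
  unfolding has_isolated_cherry_def
  using assms by (intro bexI[of _ "{x, y}"] bexI[of _ "{x, z}"] bexI[of _ "{u, v}"])
    (auto simp: doubleton_eq_iff)

section \<open>Edges and the use of connectivity\<close>

lemma edge_doubletonE:
  assumes "finite_simple_graph G" "e \<in> edges G"
  obtains x y where "e = {x, y}" "x \<noteq> y" "x \<in> vertices G" "y \<in> vertices G"
proof -
  have "e \<subseteq> vertices G" "card e = 2"
    using assms by (auto simp: finite_simple_graph_def nsets_def)
  then show ?thesis
    using that by (auto simp: card_2_iff)
qed

lemma edge_endpoints:
  assumes "finite_simple_graph G" "{x, y} \<in> edges G"
  shows "x \<noteq> y" "x \<in> vertices G" "y \<in> vertices G"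
  using assms by (auto simp: finite_simple_graph_def nsets_def)

lemma finite_edges:
  assumes "finite_simple_graph G"
  shows "finite (edges G)"
  using assms unfolding finite_simple_graph_def
  by (meson finite_imp_finite_nsets finite_subset)

text \<open>A walk from a vertex of \<open>S\<close> to one outside must leave \<open>S\<close>
  along some edge. Apart from the existence of a vertex, connectivity enters the later arguments
  only in this form.\<close>

lemma connected_graph_crossing_edge:
  assumes "finite_simple_graph G" "connected_graph G"
    and "S \<subseteq> vertices G" "S \<noteq> {}" "S \<noteq> vertices G"
  obtains x y where "x \<in> S" "y \<in> vertices G" "y \<notin> S" "{x, y} \<in> edges G"
proof -
  obtain u v where uv: "u \<in> S" "v \<in> vertices G" "v \<notin> S"
    using assms by blast
  then have "(u, v) \<in> {(x, y). {x, y} \<in> edges G}\<^sup>*"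
    using assms by (auto simp: connected_graph_def)
  \<comment> \<open>Invariant along the walk: either it is still in \<open>S\<close> or an edge
    leaving \<open>S\<close> has been met.\<close>
  then have "v \<in> S \<or> (\<exists>x y. x \<in> S \<and> y \<notin> S \<and> {x, y} \<in> edges G)"
    by (induction rule: rtrancl_induct) (use uv in auto)
  then show ?thesis
    using that uv edge_endpoints[OF assms(1)] by blast
qed

text \<open>An edge \<open>{u, v}\<close> leaves \<open>{u}\<close>, and since a third vertex
  exists, another edge leaves \<open>{u, v}\<close>. Whichever of \<open>u\<close> and
  \<open>v\<close> the second edge starts from is the centre.\<close>

lemma connected_graph_has_cherry:
  assumes "finite_simple_graph G" "connected_graph G" "card (vertices G) \<ge> 3"
  obtains a b c where "{a, b} \<in> edges G" "{a, c} \<in> edges G" "b \<noteq> c"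
proof -
  obtain u where u: "u \<in> vertices G"
    using assms by (auto simp: connected_graph_def)
  have "{u} \<noteq> vertices G"
    using assms(3) by (auto dest: arg_cong[of _ _ card])
  then obtain v where v: "v \<in> vertices G" "v \<noteq> u" "{u, v} \<in> edges G"
    using connected_graph_crossing_edge[OF assms(1,2), of "{u}"] u by blast
  have "card {u, v} = 2"
    using v by simp
  then have "{u, v} \<noteq> vertices G"
    using assms(3) by auto
  then obtain x y where "x \<in> {u, v}" "y \<notin> {u, v}" "{x, y} \<in> edges G"
    using connected_graph_crossing_edge[OF assms(1,2), of "{u, v}"] u v by blast
  then show ?thesis
    using that v by (metis insert_iff insert_commute singletonD)
qed

subsection \<open>The 1-nearly edge independence number\<close>

lemma one_nearly_edge_independent_cherry:
  assumes "e \<in> edges G" "f \<in> edges G" "e \<noteq> f" "e \<inter> f \<noteq> {}"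
  shows "one_nearly_edge_independent G {e, f}"
proof -
  have "adjacent_edge_pairs {e, f} = {{e, f}}"
    using assms by (auto simp: adjacent_edge_pairs_def)
  then show ?thesis
    using assms by (simp add: one_nearly_edge_independent_def)
qed

lemma one_nearly_edge_independent_isolated_cherry:
  assumes "e \<in> edges G" "f \<in> edges G" "g \<in> edges G" "e \<noteq> f" "e \<inter> f \<noteq> {}"
    and "g \<inter> (e \<union> f) = {}"
  shows "one_nearly_edge_independent G {e, f, g}"
proof -
  have disj: "g \<inter> e = {}" "g \<inter> f = {}" "e \<inter> g = {}" "f \<inter> g = {}"
    using assms by auto
  have "adjacent_edge_pairs {e, f, g} \<subseteq> {{e, f}}"
  proof
    fix p assume "p \<in> adjacent_edge_pairs {e, f, g}"
    then obtain x y where "p = {x, y}" "x \<in> {e, f, g}" "y \<in> {e, f, g}" "x \<noteq> y" "x \<inter> y \<noteq> {}"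
      unfolding adjacent_edge_pairs_def by blast
    then show "p \<in> {{e, f}}"
      by (elim insertE emptyE) (simp_all add: disj insert_commute)
  qed
  moreover have "{e, f} \<in> adjacent_edge_pairs {e, f, g}"
    unfolding adjacent_edge_pairs_def using assms(4,5) by blast
  ultimately have "adjacent_edge_pairs {e, f, g} = {{e, f}}"
    by blast
  then show ?thesis
    using assms by (simp add: one_nearly_edge_independent_def)
qed

text \<open>The unique adjacent pair \<open>{e, f}\<close> is the cherry. Any third member
  \<open>g\<close> of \<open>M\<close> avoids it, since meeting \<open>e\<close> or \<open>f\<close>
  would create a second adjacent pair.\<close>

lemma one_nearly_edge_independent_imp_isolated_cherry:
  assumes "one_nearly_edge_independent G M" "card M \<ge> 3"
  shows "has_isolated_cherry (edges G)"
proof -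
  have sub: "M \<subseteq> edges G"
    using assms by (simp add: one_nearly_edge_independent_def)
  obtain p where p: "adjacent_edge_pairs M = {p}"
    using assms by (auto simp: one_nearly_edge_independent_def card_1_singleton_iff)
  then have "p \<in> adjacent_edge_pairs M"
    by simp
  then obtain e f where ef: "p = {e, f}" "e \<in> M" "f \<in> M" "e \<noteq> f" "e \<inter> f \<noteq> {}"
    by (auto simp: adjacent_edge_pairs_def)
  have "card {e, f} = 2"
    using ef by simp
  then have "\<not> M \<subseteq> {e, f}"
    using assms(2) card_mono[of "{e, f}" M] by auto
  then obtain g where g: "g \<in> M" "g \<noteq> e" "g \<noteq> f"
    by auto
  have disj: "g \<inter> h = {}" if "h = e \<or> h = f" for h
  proof (rule ccontr)
    assume "g \<inter> h \<noteq> {}"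
    then have "{g, h} \<in> adjacent_edge_pairs M"
      using that ef g unfolding adjacent_edge_pairs_def by blast
    then have "{g, h} = {e, f}"
      using p ef(1) by simp
    then show False
      using g by (simp add: doubleton_eq_iff)
  qed
  have "g \<inter> (e \<union> f) = {}"
    using disj[of e] disj[of f] by auto
  then show ?thesis
    unfolding has_isolated_cherry_def using ef g sub by blast
qed

lemma one_nearly_edge_independence_number_ge:
  assumes "finite_simple_graph G" "one_nearly_edge_independent G M"
  shows "card M \<le> one_nearly_edge_independence_number G"
proof -
  have "finite {M. one_nearly_edge_independent G M}"
    by (rule finite_subset[of _ "Pow (edges G)"])
      (auto simp: one_nearly_edge_independent_def finite_edges[OF assms(1)])
  then show ?thesis
    using assms(2)
    by (auto simp: one_nearly_edge_independence_number_def intro!: Max_ge)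
qed

text \<open>The given \<open>M\<close> excludes the default value 0, so the number is a true maximum
  over a finite nonempty set.\<close>

lemma one_nearly_edge_independence_number_attained:
  assumes "finite_simple_graph G" "one_nearly_edge_independent G M"
  obtains N where "one_nearly_edge_independent G N"
    "card N = one_nearly_edge_independence_number G"
proof -
  have "finite {M. one_nearly_edge_independent G M}"
    by (rule finite_subset[of _ "Pow (edges G)"])
      (auto simp: one_nearly_edge_independent_def finite_edges[OF assms(1)])
  then have "Max {card M |M. one_nearly_edge_independent G M}
      \<in> {card M |M. one_nearly_edge_independent G M}"
    using assms(2) by (intro Max_in) auto
  then show ?thesis
    using that assms(2) by (force simp: one_nearly_edge_independence_number_def split: if_splits)
qed

lemma one_nearly_edge_independence_number_eq_2_iff:
  assumes "finite_simple_graph G" "connected_graph G" "card (vertices G) \<ge> 3"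
  shows "one_nearly_edge_independence_number G \<ge> 2"
    and "one_nearly_edge_independence_number G = 2 \<longleftrightarrow> \<not> has_isolated_cherry (edges G)"
proof -
  obtain a b c where abc: "{a, b} \<in> edges G" "{a, c} \<in> edges G" "b \<noteq> c"
    using connected_graph_has_cherry[OF assms] .
  then have M: "one_nearly_edge_independent G {{a, b}, {a, c}}"
    by (intro one_nearly_edge_independent_cherry) (auto simp: doubleton_eq_iff)
  moreover have "card {{a, b}, {a, c}} = 2"
    using abc by (simp add: doubleton_eq_iff)
  ultimately show ge: "one_nearly_edge_independence_number G \<ge> 2"
    using one_nearly_edge_independence_number_ge[OF assms(1)] by metis
  show "one_nearly_edge_independence_number G = 2 \<longleftrightarrow> \<not> has_isolated_cherry (edges G)"
  proof
    assume eq: "one_nearly_edge_independence_number G = 2"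
    show "\<not> has_isolated_cherry (edges G)"
    proof
      assume "has_isolated_cherry (edges G)"
      then obtain e f g where efg: "e \<in> edges G" "f \<in> edges G" "g \<in> edges G" "e \<noteq> f"
          "e \<inter> f \<noteq> {}" "g \<inter> (e \<union> f) = {}"
        by (auto simp: has_isolated_cherry_def)
      then have "g \<noteq> e" "g \<noteq> f"
        by auto
      then have "card {e, f, g} = 3"
        using efg(4) by (simp add: eq_commute)
      then show False
        using one_nearly_edge_independence_number_ge[OF assms(1)
            one_nearly_edge_independent_isolated_cherry[OF efg]] eq by simp
    qed
  next
    assume no: "\<not> has_isolated_cherry (edges G)"
    obtain N where "one_nearly_edge_independent G N"
        "card N = one_nearly_edge_independence_number G"
      using one_nearly_edge_independence_number_attained[OF assms(1) M] .
    then show "one_nearly_edge_independence_number G = 2"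
      \<comment> \<open>If the maximiser \<open>N\<close> had three or more edges, it would yield an
        isolated cherry.\<close>
      using one_nearly_edge_independent_imp_isolated_cherry[of G N] no ge by linarith
  qed
qed

subsection \<open>Graphs without an isolated cherry\<close>

text \<open>The cherry spans at least three vertices and the disjoint edge adds two. This settles
  every listed graph other than the stars, as those have at most four vertices.\<close>

lemma has_isolated_cherry_card_ge:
  assumes "finite_simple_graph G" "has_isolated_cherry (edges G)"
  shows "card (vertices G) \<ge> 5"
proof -
  obtain e f g where efg: "e \<in> edges G" "f \<in> edges G" "g \<in> edges G" "e \<noteq> f"
      "g \<inter> (e \<union> f) = {}"
    using assms(2) by (auto simp: has_isolated_cherry_def)
  have in_nsets: "h \<subseteq> vertices G \<and> finite h \<and> card h = 2" if "h \<in> edges G" for h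
    using assms(1) that by (auto simp: finite_simple_graph_def nsets_def)
  \<comment> \<open>Otherwise \<open>f\<close> would lie in \<open>e\<close>, and equal
    cardinalities would force \<open>e = f\<close>.\<close>
  have "e \<subset> e \<union> f"
    using efg in_nsets by (metis Un_upper1 Un_upper2 card_subset_eq psubsetI)
  then have "card e < card (e \<union> f)"
    using in_nsets efg by (intro psubset_card_mono) auto
  moreover have "card (g \<union> (e \<union> f)) = card g + card (e \<union> f)"
    using efg in_nsets by (intro card_Un_disjoint) auto
  moreover have "card (g \<union> (e \<union> f)) \<le> card (vertices G)"
    using assms(1) efg in_nsets by (intro card_mono) (auto simp: finite_simple_graph_def)
  ultimately show ?thesis
    using in_nsets efg by force
qed

text \<open>Some edge \<open>{x, y}\<close> joins the four end vertices to a fifth vertex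
  \<open>y\<close>. Together with the given edge through \<open>x\<close> it forms a cherry centred
  at \<open>x\<close>, and the other given edge is disjoint from both.\<close>

lemma isolated_cherry_if_disjoint_edges:
  assumes "finite_simple_graph G" "connected_graph G" "card (vertices G) \<ge> 5"
    and "e \<in> edges G" "f \<in> edges G" "e \<inter> f = {}"
  shows "has_isolated_cherry (edges G)"
proof -
  obtain a b where ab: "e = {a, b}" "a \<noteq> b" "a \<in> vertices G" "b \<in> vertices G"
    using edge_doubletonE[OF assms(1,4)] .
  obtain c d where cd: "f = {c, d}" "c \<noteq> d" "c \<in> vertices G" "d \<in> vertices G"
    using edge_doubletonE[OF assms(1,5)] .
  have "card {a, b, c, d} \<le> 4"
    by (simp add: card_insert_if)
  then have "{a, b, c, d} \<noteq> vertices G"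
    using assms(3) by auto
  then obtain x y where xy: "x \<in> {a, b, c, d}" "y \<notin> {a, b, c, d}" "{x, y} \<in> edges G"
    using connected_graph_crossing_edge[OF assms(1,2), of "{a, b, c, d}"] ab cd by blast
  then consider "x = a" | "x = b" | "x = c" | "x = d"
    by auto
  then show ?thesis
  proof cases
    case 1
    then show ?thesis
      using xy ab cd assms by (intro has_isolated_cherryI[of a y _ b c d]) auto
  next
    case 2
    then show ?thesis
      using xy ab cd assms
      by (intro has_isolated_cherryI[of b y _ a c d]) (auto simp: insert_commute)
  next
    case 3
    then show ?thesis
      using xy ab cd assms by (intro has_isolated_cherryI[of c y _ d a b]) auto
  next
    case 4
    then show ?thesis
      using xy ab cd assms
      by (intro has_isolated_cherryI[of d y _ c a b]) (auto simp: insert_commute)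
  qed
qed

section \<open>Stars\<close>

lemma graph_isomorphic_star:
  assumes "finite_simple_graph G" "connected_graph G" "a \<in> vertices G"
    and common: "\<And>e. e \<in> edges G \<Longrightarrow> a \<in> e"
  shows "graph_isomorphic G (star_graph (card (vertices G)))"
proof -
  let ?n = "card (vertices G)"
  have fin: "finite (vertices G)"
    using assms by (simp add: finite_simple_graph_def)
  have pos: "0 < ?n"
    using fin assms(3) by (auto simp: card_gt_0_iff)
  \<comment> \<open>By connectivity some edge leaves \<open>{v}\<close>, and its other end can only
    be the common vertex \<open>a\<close>.\<close>
  have star: "{a, v} \<in> edges G" if v: "v \<in> vertices G" "v \<noteq> a" for v
  proof -
    have "{v} \<noteq> vertices G"
      using that assms(3) by auto
    then obtain y where "{v, y} \<in> edges G"
      using connected_graph_crossing_edge[OF assms(1,2), of "{v}"] v by blast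
    then show ?thesis
      using common[of "{v, y}"] v by (auto simp: insert_commute)
  qed
  \<comment> \<open>Adjacency is an exclusive or, which also covers \<open>u = v\<close>, where
    \<open>graph_isomorphic\<close> asks about a singleton. Hence every bijection onto
    \<open>{..<?n}\<close> sending \<open>a\<close> to 0 is an isomorphism.\<close>
  have E: "{u, v} \<in> edges G \<longleftrightarrow> (u = a) \<noteq> (v = a)"
    if "u \<in> vertices G" "v \<in> vertices G" for u v
    using that star[of u] star[of v] common[of "{u, v}"] edge_endpoints(1)[OF assms(1), of u v]
    by (auto simp: insert_commute)
  have "card (vertices G - {a}) = card {0<..<?n}"
    using fin assms(3) by simp
  then obtain h where h: "bij_betw h (vertices G - {a}) {0<..<?n}"
    using fin finite_same_card_bij by blast
  let ?f = "h(a := 0)"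
  have "bij_betw ?f (insert a (vertices G - {a})) (insert 0 {0<..<?n})"
  proof (rule bij_betw_combine[of _ "{a}" "{0}", simplified])
    show "bij_betw ?f (vertices G - {a}) {0<..<?n}"
      using h by (subst bij_betw_cong[of _ _ h]) auto
  qed auto
  moreover have "insert a (vertices G - {a}) = vertices G" "insert 0 {0<..<?n} = {..<?n}"
    using assms(3) pos by auto
  ultimately have bij: "bij_betw ?f (vertices G) {..<?n}"
    by simp
  have zero: "?f u = 0 \<longleftrightarrow> u = a" if "u \<in> vertices G" for u
    using that h bij_betwE[OF h] by auto
  have "{u, v} \<in> edges G \<longleftrightarrow> {?f u, ?f v} \<in> edges (star_graph ?n)"
    if "u \<in> vertices G" "v \<in> vertices G" for u v
  proof -
    have "?f u < ?n" "?f v < ?n"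
      using bij_betwE[OF bij] that by auto
    then have "{?f u, ?f v} \<in> edges (star_graph ?n) \<longleftrightarrow> (?f u = 0) \<noteq> (?f v = 0)"
      unfolding star_graph_def by (auto simp: doubleton_eq_iff)
    then show ?thesis
      using E zero that by metis
  qed
  then show ?thesis
    unfolding graph_isomorphic_def using bij by (auto simp: star_graph_def simp del: fun_upd_apply)
qed

lemma graph_isomorphic_card:
  assumes "graph_isomorphic G H"
  shows "card (vertices G) = card (vertices H)"
  using assms bij_betw_same_card by (auto simp: graph_isomorphic_def)

text \<open>Every edge contains the unique vertex mapped to the centre 0, so no two edges are
  disjoint.\<close>

lemma star_has_no_isolated_cherry:
  assumes "finite_simple_graph G" "graph_isomorphic G (star_graph m)"
  shows "\<not> has_isolated_cherry (edges G)"
proof -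
  obtain f where f: "bij_betw f (vertices G) {..<m}"
    "\<And>u v. u \<in> vertices G \<Longrightarrow> v \<in> vertices G \<Longrightarrow>
       {u, v} \<in> edges G \<longleftrightarrow> {f u, f v} \<in> edges (star_graph m)"
    using assms(2) by (auto simp: graph_isomorphic_def star_graph_def)
  have centre: "\<exists>x\<in>e. x \<in> vertices G \<and> f x = 0" if e: "e \<in> edges G" for e
  proof -
    obtain x y where "e = {x, y}" "x \<in> vertices G" "y \<in> vertices G"
      using edge_doubletonE[OF assms(1) e] .
    then show ?thesis
      using f(2)[of x y] e by (auto simp: star_graph_def doubleton_eq_iff)
  qed
  have "e \<inter> g \<noteq> {}" if "e \<in> edges G" "g \<in> edges G" for e g
    using centre[OF that(1)] centre[OF that(2)] f(1) by (metis IntI bij_betw_def empty_iff inj_onD)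
  then show ?thesis
    unfolding has_isolated_cherry_def by blast
qed

text \<open>If all edges meet pairwise, take a cherry centred at \<open>a\<close> and an edge
  avoiding \<open>a\<close>: the latter closes a triangle, and no further vertex can be attached to
  it.\<close>

lemma no_common_vertex_cases:
  assumes G: "finite_simple_graph G" "connected_graph G" "card (vertices G) \<ge> 3"
    and no_common: "\<And>a. a \<in> vertices G \<Longrightarrow> \<exists>e\<in>edges G. a \<notin> e"
  obtains (triangle) a b c where "vertices G = {a, b, c}" "a \<noteq> b" "a \<noteq> c" "b \<noteq> c"
      "{a, b} \<in> edges G" "{a, c} \<in> edges G" "{b, c} \<in> edges G"
    | (disjoint) e f where "e \<in> edges G" "f \<in> edges G" "e \<inter> f = {}"
proof (cases "\<exists>e\<in>edges G. \<exists>f\<in>edges G. e \<inter> f = {}")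
  case True
  then show ?thesis
    using disjoint by blast
next
  case False
  then have meet: "\<And>e f. e \<in> edges G \<Longrightarrow> f \<in> edges G \<Longrightarrow> e \<inter> f \<noteq> {}"
    by blast
  obtain a b c where abc: "{a, b} \<in> edges G" "{a, c} \<in> edges G" "b \<noteq> c"
    using connected_graph_has_cherry[OF G] .
  have V: "a \<noteq> b" "a \<noteq> c" "a \<in> vertices G" "b \<in> vertices G" "c \<in> vertices G"
    using edge_endpoints[OF G(1) abc(1)] edge_endpoints[OF G(1) abc(2)] by auto
  obtain e where e: "e \<in> edges G" "a \<notin> e"
    using no_common V by blast
  obtain x y where xy: "e = {x, y}" "x \<noteq> y"
    using edge_doubletonE[OF G(1) e(1)] .
  \<comment> \<open>Avoiding \<open>a\<close>, the edge \<open>e\<close> must meet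
    \<open>{a, b}\<close> in \<open>b\<close> and \<open>{a, c}\<close> in \<open>c\<close>.\<close>
  have "e = {b, c}"
    using meet[OF e(1) abc(1)] meet[OF e(1) abc(2)] xy e(2) abc(3) by auto
  then have bc: "{b, c} \<in> edges G"
    using e by simp
  have "vertices G = {a, b, c}"
  proof (rule ccontr)
    \<comment> \<open>An edge leaving the triangle touches only one of its corners and so misses the
      opposite side.\<close>
    assume "vertices G \<noteq> {a, b, c}"
    then obtain x y where "x \<in> {a, b, c}" "y \<notin> {a, b, c}" "{x, y} \<in> edges G"
      using connected_graph_crossing_edge[OF G(1,2), of "{a, b, c}"] V by blast
    then show False
      using meet[of "{x, y}" "{a, b}"] meet[of "{x, y}" "{a, c}"] meet[of "{x, y}" "{b, c}"]
        abc bc V by auto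
  qed
  then show ?thesis
    using triangle V abc bc by blast
qed

subsection \<open>Graphs on at most four vertices\<close>

text \<open>Reduces isomorphism to an equality of edge sets. Edges are reflected as well as
  preserved because an injective map has an injective image operation on subsets of its
  domain.\<close>

lemma graph_isomorphic_image:
  assumes "inj_on f (vertices G)" "\<And>e. e \<in> edges G \<Longrightarrow> e \<subseteq> vertices G"
    and "vertices H = f ` vertices G" "edges H = (`) f ` edges G"
  shows "graph_isomorphic G H"
proof -
  have "{u, v} \<in> edges G" if uv: "u \<in> vertices G" "v \<in> vertices G"
    and im: "{f u, f v} \<in> edges H" for u v
  proof -
    obtain e where e: "e \<in> edges G" "f ` {u, v} = f ` e"
      using im assms(4) by auto
    then have "{u, v} = e"
      using inj_on_image_eq_iff[OF assms(1), of "{u, v}" e] assms(2) uv by blast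
    then show ?thesis
      using e by simp
  qed
  moreover have "{f u, f v} \<in> edges H" if "{u, v} \<in> edges G" for u v
    using imageI[OF that, of "(`) f"] assms(4) by simp
  ultimately show ?thesis
    unfolding graph_isomorphic_def using assms(1,3) by (auto simp: bij_betw_def)
qed

section \<open>Explicit edge lists of the small graphs\<close>

lemma nsets_2_four:
  "nsets {a, b, c, d} 2 \<subseteq> {{a, b}, {a, c}, {a, d}, {b, c}, {b, d}, {c, d}}"
proof
  fix e assume "e \<in> nsets {a, b, c, d} 2"
  then obtain x y where "e = {x, y}" "x \<noteq> y" "x \<in> {a, b, c, d}" "y \<in> {a, b, c, d}"
    by (auto simp: nsets_def card_2_iff)
  then show "e \<in> {{a, b}, {a, c}, {a, d}, {b, c}, {b, d}, {c, d}}"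
    by (elim insertE emptyE) (simp_all add: doubleton_eq_iff)
qed

lemma edges_complete_graph_4:
  "edges (complete_graph 4) = {{0, 1}, {0, 2}, {0, 3}, {1, 2}, {1, 3}, {2, 3}}"
proof -
  have V: "{..<4::nat} = {0, 1, 2, 3}"
    by auto
  have "{{0, 1}, {0, 2}, {0, 3}, {1, 2}, {1, 3}, {2, 3}} \<subseteq> nsets {0, 1, 2, 3 :: nat} 2"
    by (simp add: nsets_def)
  then show ?thesis
    unfolding complete_graph_def V snd_conv by (intro equalityI nsets_2_four)
qed

lemma edges_diamond_graph:
  "edges diamond_graph = {{0, 2}, {0, 3}, {1, 2}, {1, 3}, {2, 3}}"
proof -
  have "{0, 1} \<notin> {{0, 2}, {0, 3}, {1, 2}, {1, 3}, {2, 3 :: nat}}"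
    by (simp add: doubleton_eq_iff)
  then show ?thesis
    unfolding diamond_graph_def snd_conv edges_complete_graph_4 by (rule Diff_insert_absorb)
qed

lemma edges_U13_graph: "edges U13_graph = {{0, 1}, {0, 2}, {0, 3}, {1, 2}}"
proof -
  have "{i. 0 < i \<and> i < 4} = {1, 2, 3 :: nat}"
    by auto
  then show ?thesis
    by (simp add: U13_graph_def star_graph_def setcompr_eq_image insert_commute)
qed

lemma edges_path_graph_4: "edges (path_graph 4) = {{0, 1}, {1, 2}, {2, 3}}"
proof -
  have "{i. i + 1 < 4} = {0, 1, 2 :: nat}"
    by auto
  then show ?thesis
    unfolding path_graph_def snd_conv setcompr_eq_image by (simp add: insert_commute flip: numeral_2_eq_2)
qed

lemma edges_cycle_graph_4: "edges (cycle_graph 4) = {{0, 1}, {1, 2}, {2, 3}, {3, 0}}"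
proof -
  have "{i. i < 4} = {0, 1, 2, 3 :: nat}"
    by auto
  then show ?thesis
    unfolding cycle_graph_def snd_conv setcompr_eq_image by (simp add: insert_commute flip: numeral_2_eq_2)
qed

lemma edges_cycle_graph_3: "edges (cycle_graph 3) = {{0, 1}, {1, 2}, {2, 0}}"
proof -
  have "{i. i < 3} = {0, 1, 2 :: nat}"
    by auto
  then show ?thesis
    unfolding cycle_graph_def snd_conv setcompr_eq_image by (simp add: insert_commute flip: numeral_2_eq_2)
qed

section \<open>Recognising graphs on three and four vertices\<close>

lemma graph_isomorphic_cycle_graph_3:
  assumes "finite_simple_graph G" "vertices G = {a, b, c}" "a \<noteq> b" "a \<noteq> c" "b \<noteq> c"
    and "{a, b} \<in> edges G" "{a, c} \<in> edges G" "{b, c} \<in> edges G"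
  shows "graph_isomorphic G (cycle_graph 3)"
proof -
  have sub: "e \<subseteq> vertices G" if "e \<in> edges G" for e
    using assms(1) that by (auto simp: finite_simple_graph_def nsets_def)
  have E: "edges G = {{a, b}, {a, c}, {b, c}}"
  proof (rule equalityI; rule subsetI)
    fix e assume e: "e \<in> edges G"
    obtain x y where "e = {x, y}" "x \<noteq> y" "x \<in> {a, b, c}" "y \<in> {a, b, c}"
      using edge_doubletonE[OF assms(1) e] assms(2) by metis
    then show "e \<in> {{a, b}, {a, c}, {b, c}}"
      by (elim insertE emptyE) (simp_all add: doubleton_eq_iff)
  qed (use assms in blast)
  have "{..<3::nat} = {0, 1, 2}"
    by auto
  then have V: "vertices (cycle_graph 3) = {0, 1, 2}"
    by (simp add: cycle_graph_def)
  show ?thesis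
    by (rule graph_isomorphic_image[of "\<lambda>x. if x = a then 0 else if x = b then 1 else 2", OF _ sub])
      (use assms(2-5) in \<open>simp_all add: E V edges_cycle_graph_3 insert_commute\<close>)
qed

text \<open>The order in which the vertices are listed is the isomorphism: they receive the labels
  0, 1, 2, 3. Only the comparison of two explicit edge lists is left to each application.\<close>

lemma graph_isomorphic_four_vertices:
  fixes G :: "'a ugraph" and H :: "nat ugraph"
  assumes "vertices G = {a, b, c, d}" "distinct [a, b, c, d]"
    and "\<And>e. e \<in> edges G \<Longrightarrow> e \<subseteq> vertices G"
    and "vertices H = {0, 1, 2, 3}"
    and "\<And>f. f a = 0 \<Longrightarrow> f b = 1 \<Longrightarrow> f c = 2 \<Longrightarrow> f d = 3 \<Longrightarrow> edges H = (`) f ` edges G"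
  shows "graph_isomorphic G H"
proof -
  obtain f :: "'a \<Rightarrow> nat" where f: "f a = 0" "f b = 1" "f c = 2" "f d = 3"
  proof
    \<comment> \<open>The default value 0 provides the label of \<open>a\<close>.\<close>
    let ?f = "((\<lambda>_. 0)(b := 1, c := 2, d := 3)) :: 'a \<Rightarrow> nat"
    show "?f a = 0" "?f b = 1" "?f c = 2" "?f d = 3"
      using assms(2) by simp_all
  qed
  show ?thesis
    by (rule graph_isomorphic_image[OF _ assms(3) _ assms(5)[OF f]])
      (use assms(1,4) f in auto)
qed

text \<open>The path uses three of the six pairs; each of \<open>{a, c}\<close>,
  \<open>{b, d}\<close>, \<open>{a, d}\<close> may be present or not, giving eight edge sets that
  fall into five isomorphism types.\<close>

lemma four_vertices_containing_path:
  assumes G: "finite_simple_graph G" and V: "vertices G = {a, b, c, d}"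
    and dist: "distinct [a, b, c, d]"
    and path: "{a, b} \<in> edges G" "{b, c} \<in> edges G" "{c, d} \<in> edges G"
  shows "graph_isomorphic G (cycle_graph 4) \<or> graph_isomorphic G diamond_graph \<or>
    graph_isomorphic G (complete_graph 4) \<or> graph_isomorphic G U13_graph \<or>
    graph_isomorphic G (path_graph 4)"
proof -
  have sub: "e \<subseteq> vertices G" if "e \<in> edges G" for e
    using G that by (auto simp: finite_simple_graph_def nsets_def)
  have vs: "vertices (cycle_graph 4) = {0, 1, 2, 3}" "vertices diamond_graph = {0, 1, 2, 3}"
    "vertices (complete_graph 4) = {0, 1, 2, 3}" "vertices U13_graph = {0, 1, 2, 3}"
    "vertices (path_graph 4) = {0, 1, 2, 3}"
    by (simp_all add: cycle_graph_def diamond_graph_def complete_graph_def U13_graph_def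
        star_graph_def path_graph_def) auto
  have "edges G = {{a, b}, {b, c}, {c, d}} \<union> (if {a, c} \<in> edges G then {{a, c}} else {}) \<union>
      (if {b, d} \<in> edges G then {{b, d}} else {}) \<union> (if {a, d} \<in> edges G then {{a, d}} else {})"
    (is "_ = ?F")
  proof (rule equalityI; rule subsetI)
    fix e assume e: "e \<in> edges G"
    then have "e \<in> nsets {a, b, c, d} 2"
      using G unfolding finite_simple_graph_def V by blast
    from subsetD[OF nsets_2_four this] have "e \<in> {{a, b}, {a, c}, {a, d}, {b, c}, {b, d}, {c, d}}" .
    then show "e \<in> ?F"
      using e by (elim insertE emptyE) simp_all
  next
    fix e assume "e \<in> ?F"
    then show "e \<in> edges G"
      using path by (auto split: if_splits)
  qed
  \<comment> \<open>Replacing the three membership conditions by Booleans removes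
    \<open>edges G\<close> from the right-hand side.\<close>
  then obtain p q r where pqr: "edges G = {{a, b}, {b, c}, {c, d}} \<union> (if p then {{a, c}} else {}) \<union>
      (if q then {{b, d}} else {}) \<union> (if r then {{a, d}} else {})"
    by blast
  note iso = graph_isomorphic_four_vertices[OF _ _ sub]
  have ne: "a \<noteq> b" "a \<noteq> c" "a \<noteq> d" "b \<noteq> c" "b \<noteq> d" "c \<noteq> d"
    "b \<noteq> a" "c \<noteq> a" "d \<noteq> a" "c \<noteq> b" "d \<noteq> b" "d \<noteq> c"
    using dist by auto
  consider
      (path) "edges G = {{a, b}, {b, c}, {c, d}}"
    | (cycle) "edges G = {{a, b}, {b, c}, {c, d}, {a, d}}"
    | (ac) "edges G = {{a, b}, {b, c}, {c, d}, {a, c}}"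
    | (bd) "edges G = {{a, b}, {b, c}, {c, d}, {b, d}}"
    | (no_ad) "edges G = {{a, b}, {b, c}, {c, d}, {a, c}, {b, d}}"
    | (no_bd) "edges G = {{a, b}, {b, c}, {c, d}, {a, c}, {a, d}}"
    | (no_ac) "edges G = {{a, b}, {b, c}, {c, d}, {b, d}, {a, d}}"
    | (complete) "edges G = {{a, b}, {b, c}, {c, d}, {a, c}, {b, d}, {a, d}}"
    using pqr by (cases p; cases q; cases r) (simp_all add: insert_commute)
  then show ?thesis
  proof cases
    case path
    have "graph_isomorphic G (path_graph 4)"
      by (rule iso[of a b c d]) (use ne V in \<open>simp_all add: vs path edges_path_graph_4\<close>)
    then show ?thesis by blast
  next
    case cycle
    have "graph_isomorphic G (cycle_graph 4)"
      by (rule iso[of a b c d]) (use ne V in \<open>simp_all add: vs cycle edges_cycle_graph_4 insert_commute\<close>)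
    then show ?thesis by blast
  next
    case ac
    \<comment> \<open>The vertex of degree three, here \<open>c\<close>, gets label 0, its two
      neighbours in the triangle get 1 and 2, and the pendant vertex gets 3. The case
      \<open>bd\<close> follows the same pattern with \<open>b\<close> as centre.\<close>
    have "graph_isomorphic G U13_graph"
      by (rule iso[of c a b d]) (use ne V in \<open>simp_all add: vs ac edges_U13_graph insert_commute\<close>)
    then show ?thesis by blast
  next
    case bd
    have "graph_isomorphic G U13_graph"
      by (rule iso[of b c d a]) (use ne V in \<open>simp_all add: vs bd edges_U13_graph insert_commute\<close>)
    then show ?thesis by blast
  next
    case no_ad
    \<comment> \<open>The diamond lacks the edge \<open>{0, 1}\<close>, so in this and the next two
      cases the ends of the missing edge are listed first.\<close>
    have "graph_isomorphic G diamond_graph"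
      by (rule iso[of a d b c]) (use ne V in \<open>simp_all add: vs no_ad edges_diamond_graph insert_commute\<close>)
    then show ?thesis by blast
  next
    case no_bd
    have "graph_isomorphic G diamond_graph"
      by (rule iso[of b d a c]) (use ne V in \<open>simp_all add: vs no_bd edges_diamond_graph insert_commute\<close>)
    then show ?thesis by blast
  next
    case no_ac
    have "graph_isomorphic G diamond_graph"
      by (rule iso[of a c b d]) (use ne V in \<open>simp_all add: vs no_ac edges_diamond_graph insert_commute\<close>)
    then show ?thesis by blast
  next
    case complete
    have "graph_isomorphic G (complete_graph 4)"
      by (rule iso[of a b c d])
        (use ne V in \<open>simp_all add: vs complete edges_complete_graph_4 insert_commute\<close>)
    then show ?thesis by blast
  qed
qed

text \<open>By counting, \<open>e\<close> and \<open>f\<close> cover all vertices, so an edge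
  leaving \<open>e\<close> ends in \<open>f\<close> and is the middle edge of a path through all
  four.\<close>

lemma four_vertices_disjoint_edges:
  assumes G: "finite_simple_graph G" "connected_graph G" "card (vertices G) = 4"
    and ef: "e \<in> edges G" "f \<in> edges G" "e \<inter> f = {}"
  obtains a b c d where "vertices G = {a, b, c, d}" "distinct [a, b, c, d]"
    "{a, b} \<in> edges G" "{b, c} \<in> edges G" "{c, d} \<in> edges G"
proof -
  have sub: "h \<subseteq> vertices G \<and> finite h \<and> card h = 2" if "h \<in> edges G" for h
    using G(1) that by (auto simp: finite_simple_graph_def nsets_def)
  have "card (e \<union> f) = 4"
    using sub ef by (subst card_Un_disjoint) auto
  then have V: "vertices G = e \<union> f"
    using G sub ef by (metis Un_least card_subset_eq finite_simple_graph_def)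
  have ne: "e \<noteq> {}" "e \<noteq> vertices G"
    using sub[OF ef(1)] G(3) by auto
  obtain b c where bc: "b \<in> e" "c \<in> vertices G" "c \<notin> e" "{b, c} \<in> edges G"
    using connected_graph_crossing_edge[OF G(1,2), of e] sub[OF ef(1)] ne by blast
  have partner: "\<exists>y. h = {x, y} \<and> y \<noteq> x" if "h \<in> edges G" "x \<in> h" for h x
    using edge_doubletonE[OF G(1) that(1)] that(2) by (metis insert_commute insert_iff singletonD)
  obtain a where a: "e = {b, a}" "a \<noteq> b"
    using partner ef bc by blast
  obtain d where d: "f = {c, d}" "d \<noteq> c"
    using partner ef bc V by blast
  show ?thesis
    by (rule that[of a b c d]) (use V a d bc ef in \<open>auto simp: insert_commute\<close>)
qed

section \<open>Absence of an isolated cherry matched with the list of graphs\<close>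

theorem theorem3p3:
  fixes n :: nat and G :: "'a ugraph"
  assumes "n \<ge> 3"
    and "finite_simple_graph G"
    and "connected_graph G"
    and "card (vertices G) = n"
  shows "one_nearly_edge_independence_number G \<ge> 2 \<and>
    (one_nearly_edge_independence_number G = 2 \<longleftrightarrow>
      graph_isomorphic G (cycle_graph 3) \<or>
      graph_isomorphic G (cycle_graph 4) \<or>
      graph_isomorphic G diamond_graph \<or>
      graph_isomorphic G (complete_graph 4) \<or>
      graph_isomorphic G U13_graph \<or>
      graph_isomorphic G (path_graph 4) \<or>
      graph_isomorphic G (star_graph n))"
    (is "_ \<and> (_ \<longleftrightarrow> ?R)")
proof -
  have n3: "card (vertices G) \<ge> 3"
    using assms by simp
  note number = one_nearly_edge_independence_number_eq_2_iff[OF assms(2,3) n3]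
  have "\<not> has_isolated_cherry (edges G) \<longleftrightarrow> ?R"
  proof
    assume no: "\<not> has_isolated_cherry (edges G)"
    show ?R
    proof (cases "\<exists>a\<in>vertices G. \<forall>e\<in>edges G. a \<in> e")
      case True
      then show ?thesis
        using graph_isomorphic_star[OF assms(2,3)] assms(4) by blast
    next
      case False
      then have no_common: "\<And>a. a \<in> vertices G \<Longrightarrow> \<exists>e\<in>edges G. a \<notin> e"
        by blast
      show ?thesis
      proof (cases rule: no_common_vertex_cases[OF assms(2,3) n3 no_common,
            case_names _ triangle disjoint])
        case (triangle a b c)
        then show ?thesis
          using graph_isomorphic_cycle_graph_3[OF assms(2)] by blast
      next
        case (disjoint e f)
        have sub: "h \<subseteq> vertices G \<and> finite h \<and> card h = 2" if "h \<in> edges G" for h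
          using assms(2) that by (auto simp: finite_simple_graph_def nsets_def)
        have "card (e \<union> f) = 4"
          using sub disjoint by (subst card_Un_disjoint) auto
        moreover have "card (e \<union> f) \<le> card (vertices G)"
          using assms(2) sub disjoint by (intro card_mono) (auto simp: finite_simple_graph_def)
        \<comment> \<open>Two disjoint edges need four vertices, and a fifth would produce an
          isolated cherry.\<close>
        moreover have "\<not> card (vertices G) \<ge> 5"
          using isolated_cherry_if_disjoint_edges[OF assms(2,3)] disjoint no by blast
        ultimately have "card (vertices G) = 4"
          by simp
        then show ?thesis
          using four_vertices_disjoint_edges[OF assms(2,3) _ disjoint]
            four_vertices_containing_path[OF assms(2)] by metis
      qed
    qed
  next
    assume R: ?R
    show "\<not> has_isolated_cherry (edges G)"
    \<comment> \<open>Stars are treated separately because their order is unbounded; the other six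
      graphs are too small for an isolated cherry.\<close>
    proof (cases "graph_isomorphic G (star_graph n)")
      case True
      then show ?thesis
        using star_has_no_isolated_cherry[OF assms(2)] by blast
    next
      case False
      with R have "card (vertices G) \<le> 4"
        by (auto dest!: graph_isomorphic_card simp: cycle_graph_def diamond_graph_def
            complete_graph_def U13_graph_def star_graph_def path_graph_def)
      then show ?thesis
        using has_isolated_cherry_card_ge[OF assms(2)] by force
    qed
  qed
  then show ?thesis
    using number by simp
qed

end
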